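(* Let $F=F(x_1,\dots,x_r)\in\mathbb{C}[x_1,\dots,x_r]$ be a smooth form of degree $d\ge 3$, with $r\ge 2$. If $\mathrm{Aut}(F)$ consists of semi-permutations, then $|\mathrm{Aut}(F)|\le d^r\cdot r!$. Equality occurs if and only if $F$ is isomorphic to the Fermat form $x_1^d+x_2^d+\cdots+x_r^d$.
   Context: A form (homogeneous polynomial) $F\in\mathbb{C}[x_1,\dots,x_r]$ is smooth if $(0,\ldots,0)$ is the only common zero of its first partial derivatives. For $A=(a_{ij})\in\mathrm{GL}(r,\mathbb{C})$ put $A(F)=F(\sum_i a_{1i}x_i,\ldots,\sum_i a_{ri}x_i)$, and $\mathrm{Aut}(F)=\{A\in\mathrm{GL}(r,\mathbb{C})\mid A(F)=F\}$. Two forms are isomorphic if they lie in the same $\mathrm{GL}(r,\mathbb{C})$-orbit. An invertible matrix is a semi-permutation if it is a diagonal matrix up to permutation of columns. *)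

theory Defs
  imports "HOL-Analysis.Analysis" "HOL-Library.Poly_Mapping"
begin

text \<open>
  The polynomial ring over the complex numbers in the variables \<open>x\<^sub>i\<close>, where the index \<open>i\<close> ranges
  over the finite type \<open>'r\<close>: a polynomial maps each exponent vector to its coefficient.
  The ring structure is the convolution product of \<^theory>\<open>HOL-Library.Poly_Mapping\<close>.
\<close>

type_synonym 'r cpoly = "('r \<Rightarrow>\<^sub>0 nat) \<Rightarrow>\<^sub>0 complex"

definition Const :: "complex \<Rightarrow> 'r cpoly" where
  "Const c = Poly_Mapping.single 0 c"

definition Var :: "'r \<Rightarrow> 'r cpoly" where
  "Var i = Poly_Mapping.single (Poly_Mapping.single i 1) 1"

definition eval_poly :: "'r::finite cpoly \<Rightarrow> complex ^ 'r \<Rightarrow> complex" where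
  "eval_poly F x =
     (\<Sum>m\<in>Poly_Mapping.keys F. Poly_Mapping.lookup F m *
        (\<Prod>i\<in>UNIV. (x $ i) ^ Poly_Mapping.lookup m i))"

definition subst_poly :: "('r::finite \<Rightarrow> 'r cpoly) \<Rightarrow> 'r cpoly \<Rightarrow> 'r cpoly" where
  "subst_poly f F =
     (\<Sum>m\<in>Poly_Mapping.keys F. Const (Poly_Mapping.lookup F m) *
        (\<Prod>i\<in>UNIV. f i ^ Poly_Mapping.lookup m i))"

text \<open>
  Where \<open>x\<^sub>i\<close> does not occur in the monomial \<open>m\<close>, the subtraction on exponents truncates, but the
  coefficient is then \<open>0\<close>.
\<close>

definition partial_deriv :: "'r \<Rightarrow> 'r cpoly \<Rightarrow> 'r cpoly" where
  "partial_deriv i F =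
     (\<Sum>m\<in>Poly_Mapping.keys F.
        Poly_Mapping.single (m - Poly_Mapping.single i 1)
          (of_nat (Poly_Mapping.lookup m i) * Poly_Mapping.lookup F m))"

text \<open>As usual, the zero polynomial is a form of every degree.\<close>

definition form_of_degree :: "nat \<Rightarrow> 'r::finite cpoly \<Rightarrow> bool" where
  "form_of_degree d F \<longleftrightarrow> (\<forall>m\<in>Poly_Mapping.keys F. (\<Sum>i\<in>UNIV. Poly_Mapping.lookup m i) = d)"

definition smooth_form :: "'r::finite cpoly \<Rightarrow> bool" where
  "smooth_form F \<longleftrightarrow> {x. \<forall>i. eval_poly (partial_deriv i F) x = 0} = {0}"

definition GL :: "(complex ^ 'r ^ 'r::finite) set" where
  "GL = {A. invertible A}"

text \<open>
  The coefficients of the linear form substituted for \<open>x\<^sub>k\<close> are the entries of the \<open>k\<close>-th row of \<open>A\<close>.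
\<close>

definition act :: "complex ^ 'r ^ 'r \<Rightarrow> 'r::finite cpoly \<Rightarrow> 'r cpoly" where
  "act A F = subst_poly (\<lambda>k. \<Sum>i\<in>UNIV. Const (A $ k $ i) * Var i) F"

definition Aut :: "'r::finite cpoly \<Rightarrow> (complex ^ 'r ^ 'r) set" where
  "Aut F = {A \<in> GL. act A F = F}"

definition isomorphic_forms :: "'r::finite cpoly \<Rightarrow> 'r cpoly \<Rightarrow> bool" where
  "isomorphic_forms F G \<longleftrightarrow> (\<exists>A\<in>GL. act A F = G)"

definition diagonal_matrix :: "complex ^ 'r ^ 'r::finite \<Rightarrow> bool" where
  "diagonal_matrix D \<longleftrightarrow> (\<forall>i j. i \<noteq> j \<longrightarrow> D $ i $ j = 0)"

definition semi_permutation :: "complex ^ 'r ^ 'r::finite \<Rightarrow> bool" where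
  "semi_permutation A \<longleftrightarrow>
     invertible A \<and>
     (\<exists>D p. diagonal_matrix D \<and> p permutes UNIV \<and> A = (\<chi> i j. D $ i $ p j))"

definition fermat_form :: "nat \<Rightarrow> 'r::finite cpoly" where
  "fermat_form d = (\<Sum>i\<in>UNIV. Var i ^ d)"

end

theory Submission
  imports Defs
begin

text \<open>
  Smoothness at the \<open>i\<close>-th unit vector forces a monomial \<open>x\<^sub>i ^ (d - 1) * x\<^sub>j\<close> with \<open>j = j(i)\<close> to occur in \<open>F\<close>.
  Hence a diagonal symmetry \<open>t\<close> solves the system \<open>t i ^ (d - 1) * t (j i) = 1\<close>. Along the functional graph
  of \<open>j\<close>, a cycle of length \<open>k\<close> contributes at most \<open>(d - 1)\<^sup>k + 1 \<le> d\<^sup>k\<close> solutions, strictly less than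
  \<open>d\<^sup>k\<close> for \<open>k \<ge> 2\<close>, and every other vertex a factor of at most \<open>d - 1\<close>. So there are at most
  \<open>d\<^sup>r\<close> diagonal symmetries, with equality only if \<open>j\<close> is the identity and all tuples of \<open>d\<close>-th roots
  of unity are symmetries, and then \<open>F\<close> is a combination of \<open>d\<close>-th powers of the variables. The
  symmetries with a given underlying permutation are either absent or a coset of the diagonal
  ones, which gives the factor \<open>r!\<close>. Conversely, an isomorphism with the Fermat form conjugates its
  \<open>d\<^sup>r r!\<close> monomial symmetries into \<open>Aut F\<close>.
\<close>

subsection \<open>Polynomials as functions\<close>

definition eval_monomial :: "('r::finite \<Rightarrow>\<^sub>0 nat) \<Rightarrow> complex ^ 'r \<Rightarrow> complex" where
  "eval_monomial m x = (\<Prod>i\<in>UNIV. (x $ i) ^ Poly_Mapping.lookup m i)"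

lemma eval_monomial_add: "eval_monomial (m + n) x = eval_monomial m x * eval_monomial n x"
  by (simp add: eval_monomial_def lookup_add power_add prod.distrib)

lemma eval_monomial_zero [simp]: "eval_monomial 0 x = 1"
  by (simp add: eval_monomial_def)

lemma eval_monomial_single [simp]: "eval_monomial (Poly_Mapping.single i n) x = (x $ i) ^ n"
proof -
  have "eval_monomial (Poly_Mapping.single i n) x = (\<Prod>k\<in>UNIV. if k = i then (x $ k) ^ n else 1)"
    unfolding eval_monomial_def by (rule prod.cong) (auto simp: lookup_single when_def)
  then show ?thesis by simp
qed

lemma eval_monomial_mult:
  "eval_monomial m (\<chi> i. x $ i * y $ i) = eval_monomial m x * eval_monomial m y"
  by (simp add: eval_monomial_def power_mult_distrib prod.distrib)

lemma eval_poly_eq: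
  "eval_poly F x = (\<Sum>m\<in>Poly_Mapping.keys F. Poly_Mapping.lookup F m * eval_monomial m x)"
  by (simp add: eval_poly_def eval_monomial_def)

lemma eval_poly_zero [simp]: "eval_poly 0 x = 0"
  by (simp add: eval_poly_def)

lemma eval_poly_add: "eval_poly (F + G) x = eval_poly F x + eval_poly G x"
  unfolding eval_poly_eq by (rule setsum_keys_plus_distrib) (simp_all add: algebra_simps)

lemma eval_poly_sum: "eval_poly (sum f S) x = (\<Sum>i\<in>S. eval_poly (f i) x)"
  by (induction S rule: infinite_finite_induct) (simp_all add: eval_poly_add)

lemma eval_poly_single [simp]: "eval_poly (Poly_Mapping.single m c) x = c * eval_monomial m x"
  by (cases "c = 0") (simp_all add: eval_poly_eq)

lemma poly_mapping_eq_sum_single: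
  "F = (\<Sum>m\<in>Poly_Mapping.keys F. Poly_Mapping.single m (Poly_Mapping.lookup F m))"
  by (rule poly_mapping_eqI)
     (auto simp: lookup_sum lookup_single when_def in_keys_iff)

lemma eval_poly_mult: "eval_poly (F * G) x = eval_poly F x * eval_poly G x"
proof -
  \<comment> \<open>Expanding both factors into monomials leaves only products of single terms, so
    the convolution itself is never unfolded.\<close>
  have "F * G = (\<Sum>m\<in>Poly_Mapping.keys F. Poly_Mapping.single m (Poly_Mapping.lookup F m))
    * (\<Sum>n\<in>Poly_Mapping.keys G. Poly_Mapping.single n (Poly_Mapping.lookup G n))"
    by (simp only: poly_mapping_eq_sum_single[symmetric])
  also have "\<dots> = (\<Sum>m\<in>Poly_Mapping.keys F. \<Sum>n\<in>Poly_Mapping.keys G.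
      Poly_Mapping.single (m + n) (Poly_Mapping.lookup F m * Poly_Mapping.lookup G n))"
    by (simp only: sum_product mult_single)
  finally have "eval_poly (F * G) x = (\<Sum>m\<in>Poly_Mapping.keys F. \<Sum>n\<in>Poly_Mapping.keys G.
      (Poly_Mapping.lookup F m * Poly_Mapping.lookup G n) * eval_monomial (m + n) x)"
    by (simp only: eval_poly_sum eval_poly_single)
  also have "\<dots> = eval_poly F x * eval_poly G x"
    unfolding eval_poly_eq sum_product eval_monomial_add by (simp only: mult_ac)
  finally show ?thesis .
qed

lemma eval_poly_one [simp]: "eval_poly 1 x = 1"
  using eval_poly_single[of 0 1 x] by simp

lemma eval_poly_power: "eval_poly (F ^ n) x = eval_poly F x ^ n"
  by (induction n) (simp_all add: eval_poly_mult)

lemma eval_poly_prod: "eval_poly (prod f S) x = (\<Prod>i\<in>S. eval_poly (f i) x)"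
  by (induction S rule: infinite_finite_induct) (simp_all add: eval_poly_mult)

lemma eval_poly_act: "eval_poly (act A F) x = eval_poly F (A *v x)"
proof -
  have "eval_poly (act A F) x = (\<Sum>m\<in>Poly_Mapping.keys F. Poly_Mapping.lookup F m *
      (\<Prod>k\<in>UNIV. (\<Sum>i\<in>UNIV. A $ k $ i * x $ i) ^ Poly_Mapping.lookup m k))"
    by (simp add: act_def subst_poly_def eval_poly_sum eval_poly_mult eval_poly_prod
        eval_poly_power Const_def Var_def)
  then show ?thesis
    by (simp add: matrix_vector_mult_def
        eval_poly_def[of F "\<chi> k. \<Sum>i\<in>UNIV. A $ k $ i * x $ i"])
qed

lemma eval_poly_fermat_form: "eval_poly (fermat_form d) x = (\<Sum>i\<in>UNIV. (x $ i) ^ d)"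
  by (simp add: fermat_form_def eval_poly_sum eval_poly_power Var_def)

text \<open>Monomials are distinct characters of the torus, hence linearly independent.\<close>

lemma eval_monomials_independent:
  fixes c :: "('r::finite \<Rightarrow>\<^sub>0 nat) \<Rightarrow> complex"
  assumes "finite K" "\<And>x. (\<Sum>m\<in>K. c m * eval_monomial m x) = 0" "m \<in> K"
  shows "c m = 0"
  using assms
proof (induction K arbitrary: c m rule: finite_induct)
  case empty
  then show ?case by simp
next
  case (insert n K)
  have *: "c m = 0" if "m \<in> K" for m
  proof -
    have "m \<noteq> n" using that insert.hyps by auto
    then obtain i where i: "Poly_Mapping.lookup m i \<noteq> Poly_Mapping.lookup n i"
      by (auto simp: poly_mapping_eq_iff fun_eq_iff)
    \<comment> \<open>The point \<open>y\<close> separates \<open>m\<close> from \<open>n\<close>: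
      the exponents at \<open>i\<close> differ, and so do the corresponding powers of 2.\<close>
    define y :: "complex ^ 'r" where "y = (\<chi> k. if k = i then 2 else 1)"
    have y: "eval_monomial l y = 2 ^ Poly_Mapping.lookup l i" for l
    proof -
      have "eval_monomial l y = (\<Prod>k\<in>UNIV. if k = i then 2 ^ Poly_Mapping.lookup l k else 1)"
        unfolding eval_monomial_def y_def by (rule prod.cong) auto
      then show ?thesis by simp
    qed
    \<comment> \<open>Evaluating the relation at the point scaled by \<open>y\<close> and
      subtracting \<open>eval_monomial n y\<close> times the original relation cancels the term of
      \<open>n\<close>, so the induction hypothesis applies to \<open>K\<close>.\<close>
    have "(\<Sum>l\<in>K. (c l * (eval_monomial l y - eval_monomial n y)) * eval_monomial l x) = 0" for x
    proof -
      have "(\<Sum>l\<in>K. (c l * (eval_monomial l y - eval_monomial n y)) * eval_monomial l x) =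
        (\<Sum>l\<in>insert n K. (c l * (eval_monomial l y - eval_monomial n y)) * eval_monomial l x)"
        using insert.hyps by simp
      also have "\<dots> = (\<Sum>l\<in>insert n K. c l * eval_monomial l (\<chi> k. y $ k * x $ k))
        - eval_monomial n y * (\<Sum>l\<in>insert n K. c l * eval_monomial l x)"
        unfolding eval_monomial_mult sum_distrib_left sum_subtractf[symmetric]
        by (rule sum.cong) (auto simp: algebra_simps)
      also have "\<dots> = 0" unfolding insert.prems(1) by simp
      finally show ?thesis .
    qed
    from insert.IH[OF this that] have "c m * (eval_monomial m y - eval_monomial n y) = 0" .
    moreover have "(2::complex) ^ Poly_Mapping.lookup m i \<noteq> 2 ^ Poly_Mapping.lookup n i"
    proof
      assume "(2::complex) ^ Poly_Mapping.lookup m i = 2 ^ Poly_Mapping.lookup n i"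
      from arg_cong[where f = norm, OF this] show False
        using i by (simp add: norm_power)
    qed
    ultimately show ?thesis by (simp add: y)
  qed
  have "c n = 0"
    using insert.prems(1)[of "\<chi> i. 1"] insert.hyps * by (simp add: eval_monomial_def)
  with * insert.prems(2) show ?case by blast
qed

text \<open>By independence of monomials, identities such as \<open>act A F = F\<close> can be
  checked pointwise, where \<open>act A\<close> is merely composition with
  \<open>A *v\<close>.\<close>

lemma eval_poly_eq_iff: "F = G \<longleftrightarrow> (\<forall>x. eval_poly F x = eval_poly G x)"
proof (intro iffI allI)
  assume eq: "\<forall>x. eval_poly F x = eval_poly G x"
  define H where "H = F - G"
  have "eval_poly H x = 0" for x
    using eval_poly_add[of H G x] eq by (simp add: H_def)
  then have "Poly_Mapping.lookup H m = 0" if "m \<in> Poly_Mapping.keys H" for m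
    using eval_monomials_independent[OF finite_keys _ that] by (simp add: eval_poly_eq)
  then have "H = 0"
    by (intro poly_mapping_eqI) (metis in_keys_iff lookup_zero)
  then show "F = G" by (simp add: H_def)
qed simp

lemma mem_Aut_iff: "A \<in> Aut F \<longleftrightarrow> invertible A \<and> (\<forall>x. eval_poly F (A *v x) = eval_poly F x)"
  by (simp add: Aut_def GL_def eval_poly_eq_iff[of "act A F"] eval_poly_act)

text \<open>
  Otherwise all partial derivatives of \<open>F\<close> vanish at the \<open>i\<close>-th unit vector.
\<close>

lemma smooth_form_near_power:
  fixes F :: "'r::finite cpoly"
  assumes "form_of_degree d F" "smooth_form F"
  shows "\<exists>j. Poly_Mapping.single i (d - 1) + Poly_Mapping.single j 1 \<in> Poly_Mapping.keys F"
proof -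
  define e :: "complex ^ 'r" where "e = axis i 1"
  have "e \<noteq> 0" by (simp add: e_def axis_eq_0_iff)
  then obtain j where "eval_poly (partial_deriv j F) e \<noteq> 0"
    using assms(2) unfolding smooth_form_def by blast
  then have "(\<Sum>m\<in>Poly_Mapping.keys F. of_nat (Poly_Mapping.lookup m j) * Poly_Mapping.lookup F m
      * eval_monomial (m - Poly_Mapping.single j 1) e) \<noteq> 0"
    by (simp add: partial_deriv_def eval_poly_sum)
  then obtain m where m: "m \<in> Poly_Mapping.keys F" "Poly_Mapping.lookup m j \<noteq> 0"
      "eval_monomial (m - Poly_Mapping.single j 1) e \<noteq> 0"
    by (metis (no_types, lifting) sum.neutral mult_eq_0_iff of_nat_0)
  define l where "l = m - Poly_Mapping.single j 1"
  have ml: "m = l + Poly_Mapping.single j 1"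
    by (rule poly_mapping_eqI)
       (use m(2) in \<open>auto simp: l_def lookup_add lookup_minus lookup_single when_def\<close>)
  \<comment> \<open>The unit vector \<open>e\<close> vanishes off \<open>i\<close>, so a monomial
    that is nonzero there is a pure power of the variable at \<open>i\<close>.\<close>
  have l0: "Poly_Mapping.lookup l k = 0" if "k \<noteq> i" for k
  proof (rule ccontr)
    assume "Poly_Mapping.lookup l k \<noteq> 0"
    then have "(e $ k) ^ Poly_Mapping.lookup l k = 0"
      using that by (simp add: e_def axis_def)
    then have "eval_monomial l e = 0" unfolding eval_monomial_def
      by (intro prod_zero) auto
    then show False using m(3) by (simp add: l_def)
  qed
  have "(\<Sum>k\<in>UNIV. Poly_Mapping.lookup m k) = d"
    using assms(1) m(1) by (simp add: form_of_degree_def)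
  then have "(\<Sum>k\<in>UNIV. Poly_Mapping.lookup l k) + 1 = d"
    by (simp add: ml lookup_add sum.distrib lookup_single when_def)
  moreover have "(\<Sum>k\<in>UNIV. Poly_Mapping.lookup l k) = Poly_Mapping.lookup l i"
    using sum.remove[of UNIV i "Poly_Mapping.lookup l"] l0 by simp
  ultimately have "l = Poly_Mapping.single i (d - 1)"
    by (intro poly_mapping_eqI) (auto simp: lookup_single when_def l0)
  with m(1) ml show ?thesis by auto
qed

subsection \<open>Monomial systems of equations\<close>

text \<open>Each equation says that a near-power monomial takes the value 1 at \<open>t\<close>. The
  choice \<open>j i = i\<close> is allowed and, for positive \<open>d\<close>, gives
  \<open>t i ^ d = 1\<close>.\<close>

definition monomial_system :: "nat \<Rightarrow> ('r \<Rightarrow> 'r) \<Rightarrow> ('r \<Rightarrow> complex) set" where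
  "monomial_system d j = {t. \<forall>i. t i ^ (d - 1) * t (j i) = 1}"

lemma card_roots_mult_le:
  fixes c :: complex
  assumes "n > 0"
  shows "finite {z. z ^ n * c = 1}" "card {z. z ^ n * c = 1} \<le> n"
proof -
  \<comment> \<open>A vanishing \<open>c\<close> leaves no solutions; allowing it lets the lemma be
    applied to arbitrary prescribed values.\<close>
  have "{z. z ^ n * c = 1} = (if c = 0 then {} else {z. z ^ n = 1 / c})"
    by (auto simp: field_simps)
  then show "finite {z. z ^ n * c = 1}" "card {z. z ^ n * c = 1} \<le> n"
    using assms card_nth_roots[of "1 / c" n] finite_nth_roots[of n "1 / c"] by auto
qed

text \<open>The map is the power with exponent \<open>-n\<close>, so its \<open>k\<close>-th iterate
  has exponent \<open>(-n)^k\<close>, whose sign is given by the parity of \<open>k\<close>.\<close>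

lemma funpow_inverse_power:
  fixes z :: complex
  shows "((\<lambda>z. inverse (z ^ n)) ^^ k) z = (if even k then z ^ (n ^ k) else inverse (z ^ (n ^ k)))"
  by (induction k) (auto simp: power_inverse power_mult[symmetric] mult.commute)

text \<open>On a cycle of length \<open>k\<close>, a solution of the system is determined by one
  value, which must return to itself after \<open>k\<close> inverse powers. This bounds the possible
  values.\<close>

lemma card_periodic_inverse_power:
  fixes n k :: nat
  assumes "n \<ge> 2" "k > 0"
  defines "Z \<equiv> {z::complex. z \<noteq> 0 \<and> ((\<lambda>z. inverse (z ^ n)) ^^ k) z = z}"
  shows "finite Z" "card Z \<le> n ^ k + 1"
proof -
  have "n ^ k \<ge> 2"
    using assms power_increasing[of 1 k n] by simp
  \<comment> \<open>This is the absolute value of \<open>(-n)^k - 1\<close>; nonzero fixed points of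
    the iterate are \<open>N\<close>-th roots of unity.\<close>
  define N where "N = (if even k then n ^ k - 1 else n ^ k + 1)"
  have N: "N > 0" "N \<le> n ^ k + 1" using \<open>n ^ k \<ge> 2\<close> by (auto simp: N_def)
  have "Z \<subseteq> {z. z ^ N = 1}"
  proof
    fix z assume "z \<in> Z"
    then have z: "z \<noteq> 0" "((\<lambda>z. inverse (z ^ n)) ^^ k) z = z" by (auto simp: Z_def)
    show "z \<in> {z. z ^ N = 1}"
    proof (cases "even k")
      case True
      have "z ^ (n ^ k) = z * z ^ (n ^ k - 1)"
        using power_minus_mult[of "n ^ k" z] assms(1) by (simp add: mult.commute)
      then show ?thesis using True z by (simp add: funpow_inverse_power N_def)
    next
      case False
      then have "inverse (z ^ (n ^ k)) = z" using z(2) by (simp add: funpow_inverse_power)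
      then have "z ^ (n ^ k) * z = 1" using z(1)
        by (metis nonzero_imp_inverse_nonzero inverse_inverse_eq right_inverse)
      then show ?thesis using False by (simp add: N_def mult.commute)
    qed
  qed
  moreover have "finite {z::complex. z ^ N = 1}" "card {z::complex. z ^ N = 1} \<le> N"
    using card_roots_mult_le[OF N(1), of 1] by simp_all
  ultimately show "finite Z" "card Z \<le> n ^ k + 1"
    using N(2) card_mono[of "{z. z ^ N = 1}" Z] by (auto intro: finite_subset)
qed

text \<open>With \<open>n = d - 1\<close> this is the strict loss on cycles of length at least two;
  for \<open>k = 1\<close> both sides would agree.\<close>

lemma power_add_one_less:
  fixes n k :: nat
  assumes "n > 0" "k \<ge> 2"
  shows "n ^ k + 1 < (n + 1) ^ k"
  using assms(2)
proof (induction k rule: dec_induct)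
  case base
  then show ?case using assms(1) by (simp add: power2_eq_square)
next
  case (step k)
  have "n ^ Suc k + 1 \<le> (n ^ k + 1) * (n + 1)" by simp
  also have "\<dots> < (n + 1) ^ k * (n + 1)"
    using step.IH by (intro mult_strict_right_mono) auto
  finally show ?case by (simp add: mult.commute)
qed

text \<open>The orbit of \<open>i\<close> is finite, hence revisits some point \<open>a\<close>;
  minimality of the period \<open>k\<close> makes the first \<open>k\<close> iterates of
  \<open>a\<close> distinct.\<close>

lemma exists_cycle:
  fixes j :: "'r::finite \<Rightarrow> 'r"
  assumes "i \<in> U" "j ` U \<subseteq> U"
  obtains a k where "a \<in> U" "k > 0" "(j ^^ k) a = a" "inj_on (\<lambda>n. (j ^^ n) a) {..<k}"
    "\<And>n. (j ^^ n) a \<in> U"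
proof -
  have U: "(j ^^ n) x \<in> U" if "x \<in> U" for n x
    using that assms(2) by (induction n) auto
  have "\<not> inj (\<lambda>n. (j ^^ n) i)"
    using finite_imageD[of "\<lambda>n. (j ^^ n) i" UNIV] by auto
  then obtain x y where xy: "(j ^^ x) i = (j ^^ y) i" "x < y"
    unfolding inj_def by (metis nat_neq_iff)
  define a where "a = (j ^^ x) i"
  have "(j ^^ (y - x)) a = (j ^^ (y - x + x)) i"
    by (simp only: funpow_add o_apply a_def)
  then have a: "(j ^^ (y - x)) a = a" "y - x > 0"
    using xy by (simp_all add: a_def)
  define k where "k = (LEAST k. k > 0 \<and> (j ^^ k) a = a)"
  have k: "k > 0 \<and> (j ^^ k) a = a"
    unfolding k_def by (rule LeastI[of _ "y - x"]) (use a in auto)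
  have "inj_on (\<lambda>n. (j ^^ n) a) {..<k}"
  proof (rule linorder_inj_onI)
    fix p q assume pq: "p < q" "p \<in> {..<k}" "q \<in> {..<k}"
    show "(j ^^ p) a \<noteq> (j ^^ q) a"
    proof
      assume "(j ^^ p) a = (j ^^ q) a"
      \<comment> \<open>Advancing both sides by \<open>k - q\<close> turns a coincidence into the
        period \<open>k - q + p\<close>, positive but smaller than \<open>k\<close>.\<close>
      then have "(j ^^ (k - q)) ((j ^^ p) a) = (j ^^ (k - q)) ((j ^^ q) a)" by simp
      then have "(j ^^ (k - q + p)) a = (j ^^ (k - q + q)) a"
        by (simp only: funpow_add o_apply)
      then have "(j ^^ (k - q + p)) a = a" using pq k by simp
      then have "k \<le> k - q + p"
        unfolding k_def using pq by (intro Least_le) (auto simp: k_def[symmetric])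
      then show False using pq by simp
    qed
  qed auto
  then show ?thesis
    using that[of a k] k U[of i] U[of a] assms(1) by (simp add: a_def)
qed

text \<open>
  The induction enlarges \<open>S\<close> by a point that \<open>j\<close> maps into \<open>S\<close> if there is one; otherwise \<open>-S\<close> is
  closed under \<open>j\<close>, and \<open>S\<close> is enlarged by a cycle, on which one value of \<open>t\<close> determines the others.
\<close>

lemma card_monomial_system_extensions:
  fixes j :: "'r::finite \<Rightarrow> 'r"
  assumes d: "d \<ge> 3" and "j ` S \<subseteq> S"
  shows "finite {t \<in> monomial_system d j. \<forall>i\<in>S. t i = c i} \<and>
    card {t \<in> monomial_system d j. \<forall>i\<in>S. t i = c i} \<le> d ^ card (- S) \<and>
    ((\<exists>i\<in>-S. j i \<noteq> i) \<longrightarrow>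
      card {t \<in> monomial_system d j. \<forall>i\<in>S. t i = c i} < d ^ card (- S))"
  using assms(2)
proof (induction "card (- S)" arbitrary: S c rule: less_induct)
  case less
  define X where "X = (\<lambda>S c. {t \<in> monomial_system d j. \<forall>i\<in>S. t i = c i})"
  let ?bounded = "finite (X S c) \<and> card (X S c) \<le> d ^ card (- S) \<and>
      ((\<exists>i\<in>-S. j i \<noteq> i) \<longrightarrow> card (X S c) < d ^ card (- S))"
  \<comment> \<open>Common to both ways of enlarging \<open>S\<close>: \<open>Z\<close> parametrises
    the values on the new block \<open>Q\<close>, and the induction hypothesis counts the rest. If
    \<open>Z\<close> has the full size \<open>d ^ card Q\<close>, then \<open>j\<close> fixes
    \<open>Q\<close> pointwise, so a point moved by \<open>j\<close> lies outside
    \<open>S \<union> Q\<close> and the strictness comes from there.\<close>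
  have extend: ?bounded
    if O: "Q \<inter> S = {}" "Q \<noteq> {}" "j ` Q \<subseteq> Q \<union> S" and Z: "finite Z" "card Z \<le> d ^ card Q"
      "card Z < d ^ card Q \<or> (\<forall>i\<in>Q. j i = i)"
      and sub: "X S c \<subseteq> (\<Union>z\<in>Z. X (S \<union> Q) (e z))" for Q and Z :: "complex set" and e
  proof -
    define b where "b = d ^ card (- (S \<union> Q))"
    have "- S = Q \<union> - (S \<union> Q)" "Q \<inter> - (S \<union> Q) = {}" using O(1) by auto
    then have card: "card (- S) = card Q + card (- (S \<union> Q))"
      using card_Un_disjoint[of Q "- (S \<union> Q)"] by simp
    have "card Q > 0" using O(2) by (simp add: card_gt_0_iff)
    then have "card (- (S \<union> Q)) < card (- S)" using card by simp
    moreover have "j ` (S \<union> Q) \<subseteq> S \<union> Q" using O(3) less.prems by auto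
    ultimately have "finite (X (S \<union> Q) c') \<and> card (X (S \<union> Q) c') \<le> b \<and>
        ((\<exists>i\<in>-(S \<union> Q). j i \<noteq> i) \<longrightarrow> card (X (S \<union> Q) c') < b)" for c'
      unfolding X_def b_def by (rule less.hyps)
    then have IH: "finite (X (S \<union> Q) c')" "card (X (S \<union> Q) c') \<le> b"
        "\<exists>i\<in>-(S \<union> Q). j i \<noteq> i \<Longrightarrow> card (X (S \<union> Q) c') < b" for c'
      by simp_all
    have fin: "finite (\<Union>z\<in>Z. X (S \<union> Q) (e z))" using Z(1) IH(1) by auto
    have "card (X S c) \<le> card (\<Union>z\<in>Z. X (S \<union> Q) (e z))" by (rule card_mono[OF fin sub])
    also have "\<dots> \<le> (\<Sum>z\<in>Z. card (X (S \<union> Q) (e z)))" by (rule card_UN_le[OF Z(1)])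
    finally have le: "card (X S c) \<le> (\<Sum>z\<in>Z. card (X (S \<union> Q) (e z)))" .
    have b0: "b > 0" using d by (simp add: b_def)
    have dd: "d ^ card (- S) = d ^ card Q * b" by (simp add: card power_add b_def)
    have le': "card (X S c) \<le> card Z * b"
      using le sum_bounded_above[of Z "\<lambda>z. card (X (S \<union> Q) (e z))" b] IH(2) by simp
    have strict: "card (X S c) < d ^ card Q * b" if ex: "\<exists>i\<in>-S. j i \<noteq> i"
    proof (cases "card Z < d ^ card Q")
      case True
      then have "card Z * b < d ^ card Q * b" using b0 by simp
      with le' show ?thesis by (rule le_less_trans)
    next
      case False
      then have "\<exists>i\<in>-(S \<union> Q). j i \<noteq> i" using Z(3) ex by auto
      then have "card (X (S \<union> Q) (e z)) \<le> b - 1" for z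
        using IH(3)[of "e z"] by simp
      then have "card (X S c) \<le> card Z * (b - 1)"
        using le sum_bounded_above[of Z "\<lambda>z. card (X (S \<union> Q) (e z))" "b - 1"] by simp
      also have "\<dots> \<le> d ^ card Q * (b - 1)" using Z(2) by simp
      also have "\<dots> < d ^ card Q * b" using b0 d by simp
      finally show ?thesis .
    qed
    have "card (X S c) \<le> d ^ card Q * b"
      using le' mult_le_mono1[OF Z(2)] by (rule le_trans)
    then show ?thesis
      using finite_subset[OF sub fin] strict unfolding dd by simp
  qed
  show ?case
  proof (cases "S = UNIV")
    case True
    have "{t \<in> monomial_system d j. \<forall>i\<in>S. t i = c i} \<subseteq> {c}" using True by auto
    from this card_mono[OF _ this] finite_subset[OF this] show ?thesis
      using True by simp
  next
    case ne: False
    show ?thesis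
    proof (cases "\<exists>i. i \<notin> S \<and> j i \<in> S")
      case True
      then obtain i where i: "i \<notin> S" "j i \<in> S" by auto
      \<comment> \<open>The value at \<open>j i\<close> is already prescribed, so at most
        \<open>d - 1\<close> values remain at \<open>i\<close>, which is a strict loss.\<close>
      let ?Z = "{z. z ^ (d - 1) * c (j i) = 1}"
      have "X S c \<subseteq> (\<Union>z\<in>?Z. X (S \<union> {i}) (c(i := z)))"
      proof
        fix t assume t: "t \<in> X S c"
        then have "t i ^ (d - 1) * t (j i) = 1" "t (j i) = c (j i)"
          using i(2) unfolding X_def monomial_system_def by blast+
        then have "t i \<in> ?Z" by simp
        moreover have "t \<in> X (S \<union> {i}) (c(i := t i))" using t by (auto simp: X_def)
        ultimately show "t \<in> (\<Union>z\<in>?Z. X (S \<union> {i}) (c(i := z)))" by blast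
      qed
      moreover have "finite ?Z" "card ?Z < d"
        using card_roots_mult_le[of "d - 1" "c (j i)"] d by simp_all
      ultimately have ?bounded
        using extend[of "{i}" ?Z "\<lambda>z. c(i := z)"] i d by simp
      then show ?thesis unfolding X_def .
    next
      case False
      then have closed: "j ` (- S) \<subseteq> - S" by auto
      from ne obtain i where "i \<in> - S" by auto
      from exists_cycle[OF this closed] obtain a k where
        a: "a \<in> - S" "k > 0" "(j ^^ k) a = a" "inj_on (\<lambda>n. (j ^^ n) a) {..<k}"
          "\<And>n. (j ^^ n) a \<in> - S" by blast
      define Q where "Q = (\<lambda>n. (j ^^ n) a) ` {..<k}"
      define g :: "complex \<Rightarrow> complex" where "g = (\<lambda>z. inverse (z ^ (d - 1)))"
      define Z where "Z = {z. z \<noteq> 0 \<and> (g ^^ k) z = z}"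
      \<comment> \<open>Off \<open>S\<close>, the value at a point of the cycle is obtained from
        \<open>z\<close>, the value at \<open>a\<close>, by iterating \<open>g\<close>. Any
        \<open>n\<close> leading from \<open>a\<close> to \<open>x\<close> serves, because a
        solution \<open>t\<close> satisfies \<open>t ((j ^^ n) a) = (g ^^ n) (t a)\<close> for every
        \<open>n\<close>.\<close>
      define e where "e = (\<lambda>z x. if x \<in> S then c x else (g ^^ (SOME n. x = (j ^^ n) a)) z)"
      have cardQ: "card Q = k" using a(4) by (simp add: Q_def card_image)
      have Z: "finite Z" "card Z \<le> (d - 1) ^ k + 1"
        using card_periodic_inverse_power[of "d - 1" k] d a(2) by (simp_all add: Z_def g_def)
      have sub: "X S c \<subseteq> (\<Union>z\<in>Z. X (S \<union> Q) (e z))"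
      proof
        fix t assume t: "t \<in> X S c"
        then have eq: "t x ^ (d - 1) * t (j x) = 1" for x
          by (auto simp: X_def monomial_system_def)
        have step: "t (j x) = g (t x)" for x
          using inverse_unique[OF eq[of x]] by (simp add: g_def)
        have pow: "t ((j ^^ n) a) = (g ^^ n) (t a)" for n
          by (induction n) (simp_all add: step)
        have "t a \<noteq> 0" using eq[of a] d by (auto simp: power_0_left)
        then have "t a \<in> Z" using pow[of k] a(3) by (simp add: Z_def)
        moreover have "t x = e (t a) x" if "x \<in> S \<union> Q" for x
        proof (cases "x \<in> S")
          case True
          then show ?thesis using t by (simp add: X_def e_def)
        next
          case False
          then have "\<exists>n. x = (j ^^ n) a" using that by (auto simp: Q_def)
          then have "x = (j ^^ (SOME n. x = (j ^^ n) a)) a" by (rule someI_ex)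
          then have "t x = (g ^^ (SOME n. x = (j ^^ n) a)) (t a)" using pow by metis
          then show ?thesis using False by (simp add: e_def)
        qed
        then have "t \<in> X (S \<union> Q) (e (t a))" using t by (simp add: X_def)
        ultimately show "t \<in> (\<Union>z\<in>Z. X (S \<union> Q) (e z))" by blast
      qed
      have "j x \<in> Q" if "x \<in> Q" for x
      proof -
        from that obtain n where n: "n < k" "x = (j ^^ n) a" by (auto simp: Q_def)
        then have jx: "j x = (j ^^ Suc n) a" by simp
        show ?thesis
        proof (cases "Suc n = k")
          case True
          then have "j x = (j ^^ 0) a" using jx a(3) by simp
          then show ?thesis unfolding Q_def using a(2) by blast
        next
          case False
          then show ?thesis unfolding Q_def jx using n(1) by (intro imageI) simp
        qed
      qed
      then have Q: "Q \<inter> S = {}" "Q \<noteq> {}" "j ` Q \<subseteq> Q \<union> S"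
        using a(2,5) by (auto simp: Q_def)
      have "card Z \<le> d ^ card Q \<and> (card Z < d ^ card Q \<or> (\<forall>i\<in>Q. j i = i))"
      \<comment> \<open>A fixed point admits up to \<open>(d - 1) + 1 = d\<close> values, so only
        here can the bound be attained.\<close>
      proof (cases "k = 1")
        case True
        then have "Q = {a}" by (simp add: Q_def lessThan_Suc)
        then show ?thesis using Z(2) True d a(3) by simp
      next
        case False
        then have "(d - 1) ^ k + 1 < d ^ k"
          using power_add_one_less[of "d - 1" k] a(2) d by simp
        then show ?thesis using Z(2) cardQ by simp
      qed
      then have ?bounded using extend[OF Q Z(1) _ _ sub] by simp
      then show ?thesis unfolding X_def .
    qed
  qed
qed

lemma card_monomial_system:
  fixes j :: "'r::finite \<Rightarrow> 'r"
  assumes "d \<ge> 3"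
  shows "finite (monomial_system d j)"
    "card (monomial_system d j) \<le> d ^ CARD('r)"
    "j i \<noteq> i \<Longrightarrow> card (monomial_system d j) < d ^ CARD('r)"
  using card_monomial_system_extensions[OF assms, of j "{}"] by (auto simp: Compl_eq_Diff_UNIV)

subsection \<open>Monomial matrices and symmetries\<close>

text \<open>Coordinates for semi-permutations: a pair \<open>(t, p)\<close> with \<open>t\<close>
  indexed by rows, so that matrices can be counted as pairs.\<close>

definition monomial_matrix :: "('r \<Rightarrow> complex) \<Rightarrow> ('r \<Rightarrow> 'r) \<Rightarrow> complex ^ 'r ^ 'r::finite" where
  "monomial_matrix t p = (\<chi> i j. if i = p j then t i else 0)"

lemma monomial_matrix_mult:
  assumes "p permutes UNIV"
  shows "monomial_matrix t p *v x = (\<chi> i. t i * x $ inv p i)"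
proof -
  have "(\<Sum>k\<in>UNIV. (if i = p k then t i else 0) * x $ k) = t i * x $ inv p i" for i
  proof -
    have "(\<Sum>k\<in>UNIV. (if i = p k then t i else 0) * x $ k)
      = (\<Sum>k\<in>UNIV. if k = inv p i then t i * x $ k else 0)"
      by (rule sum.cong) (auto simp: permutes_inverses[OF assms])
    then show ?thesis by simp
  qed
  then show ?thesis by (simp add: monomial_matrix_def matrix_vector_mult_def)
qed

lemma invertible_iff_ker:
  fixes A :: "complex ^ 'r ^ 'r::finite"
  shows "invertible A \<longleftrightarrow> (\<forall>x. A *v x = 0 \<longrightarrow> x = 0)"
  by (simp add: invertible_left_inverse matrix_left_invertible_ker)

lemma invertible_monomial_matrix_iff:
  assumes "p permutes (UNIV :: 'r::finite set)"
  shows "invertible (monomial_matrix t p) \<longleftrightarrow> (\<forall>i. t i \<noteq> 0)"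
proof
  assume inv: "invertible (monomial_matrix t p)"
  show "\<forall>i. t i \<noteq> 0"
  proof (intro allI notI)
    fix i assume i: "t i = 0"
    \<comment> \<open>The matrix sends the unit vector at \<open>inv p i\<close> to
      \<open>t i\<close> times the one at \<open>i\<close>, so this vector lies in the
      kernel.\<close>
    have "t k * axis (inv p i) 1 $ inv p k = 0" for k
    proof (cases "k = i")
      case False
      then have "inv p k \<noteq> inv p i" by (metis permutes_inverses(1)[OF assms])
      then show ?thesis by (simp add: axis_def)
    qed (simp add: i)
    then have "monomial_matrix t p *v axis (inv p i) 1 = 0"
      by (simp add: monomial_matrix_mult[OF assms] vec_eq_iff)
    then have "axis (inv p i) 1 = (0 :: complex ^ 'r)"
      using inv unfolding invertible_iff_ker by blast
    then show False by (simp add: axis_eq_0_iff)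
  qed
next
  assume t: "\<forall>i. t i \<noteq> 0"
  show "invertible (monomial_matrix t p)"
    unfolding invertible_iff_ker
  proof (intro allI impI)
    fix x assume "monomial_matrix t p *v x = 0"
    then have "x $ inv p i = 0" for i
      using t by (simp add: monomial_matrix_mult[OF assms] vec_eq_iff)
    then have "x $ i = 0" for i
      using permutes_inverses(2)[OF assms, of i] by metis
    then show "x = 0" by (simp add: vec_eq_iff)
  qed
qed

lemma semi_permutation_monomial_matrix:
  assumes "semi_permutation A"
  obtains t p where "p permutes UNIV" "\<And>i. t i \<noteq> 0" "A = monomial_matrix t p"
proof -
  obtain D p where A: "invertible A" "diagonal_matrix D" "p permutes UNIV"
      "A = (\<chi> i j. D $ i $ p j)"
    using assms by (auto simp: semi_permutation_def)
  have "A = monomial_matrix (\<lambda>i. D $ i $ i) p"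
    using A(2,4) by (auto simp: vec_eq_iff monomial_matrix_def diagonal_matrix_def)
  then show ?thesis
    using that[OF A(3), of "\<lambda>i. D $ i $ i"] A(1) invertible_monomial_matrix_iff[OF A(3)] by simp
qed

text \<open>Nonzero entries show where \<open>p\<close> places each column; if entries of
  \<open>t\<close> vanished, \<open>p\<close> could not be recovered.\<close>

lemma monomial_matrix_inject:
  assumes "monomial_matrix t p = monomial_matrix s q" "\<And>i. t i \<noteq> 0" "p permutes UNIV"
  shows "t = s \<and> p = q"
proof -
  have eq: "(if i = p k then t i else 0) = (if i = q k then s i else 0)" for i k
    using assms(1) by (simp add: monomial_matrix_def vec_eq_iff)
  have pq: "p k = q k" for k
    using eq[of "p k" k] assms(2) by (auto split: if_splits)
  have "t i = s i" for i
    using eq[of i "inv p i"] pq[of "inv p i"] permutes_inverses(1)[OF assms(3), of i] by simp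
  with pq show ?thesis by auto
qed

section \<open>Diagonal symmetries and the bound on the automorphism group\<close>

definition diagonal_symmetries :: "'r::finite cpoly \<Rightarrow> ('r \<Rightarrow> complex) set" where
  "diagonal_symmetries F =
    {t. (\<forall>i. t i \<noteq> 0) \<and> (\<forall>x. eval_poly F (\<chi> i. t i * x $ i) = eval_poly F x)}"

text \<open>Scaling by \<open>t\<close> multiplies each coefficient by the value of its monomial at
  \<open>t\<close>; by independence this factor is 1 wherever the coefficient is nonzero.\<close>

lemma diagonal_symmetries_monomial:
  assumes "t \<in> diagonal_symmetries F" "m \<in> Poly_Mapping.keys F"
  shows "eval_monomial m (\<chi> i. t i) = 1"
proof -
  have "(\<Sum>m\<in>Poly_Mapping.keys F. (Poly_Mapping.lookup F m * (eval_monomial m (\<chi> i. t i) - 1))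
      * eval_monomial m x) = 0" for x
  proof -
    have "eval_poly F (\<chi> i. (\<chi> i. t i) $ i * x $ i) = eval_poly F x"
      using assms(1) by (simp add: diagonal_symmetries_def)
    then show ?thesis
      unfolding eval_poly_eq eval_monomial_mult
      by (simp add: algebra_simps sum_subtractf)
  qed
  from eval_monomials_independent[OF finite_keys this assms(2)] assms(2)
  show ?thesis by (simp add: in_keys_iff)
qed

lemma diagonal_symmetries_subset_monomial_system:
  assumes "\<And>i. Poly_Mapping.single i (d - 1) + Poly_Mapping.single (j i) 1 \<in> Poly_Mapping.keys F"
  shows "diagonal_symmetries F \<subseteq> monomial_system d j"
proof
  fix t assume "t \<in> diagonal_symmetries F"
  from diagonal_symmetries_monomial[OF this assms]
  show "t \<in> monomial_system d j"
    by (simp add: monomial_system_def eval_monomial_add)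
qed

text \<open>Dividing by a fixed symmetry with the same permutation embeds each of the
  \<open>r!\<close> fibres into the diagonal symmetries.\<close>

lemma card_Aut_le:
  fixes F :: "'r::finite cpoly"
  assumes semi: "\<forall>A\<in>Aut F. semi_permutation A" and fin: "finite (diagonal_symmetries F)"
  shows "finite (Aut F)"
    "card (Aut F) \<le> card (diagonal_symmetries F) * fact CARD('r)"
proof -
  define P where "P = {p :: 'r \<Rightarrow> 'r. p permutes UNIV}"
  define W where "W = (\<lambda>p. {t. (\<forall>i. t i \<noteq> 0) \<and> monomial_matrix t p \<in> Aut F})"
  have P: "finite P" "card P = fact CARD('r)"
    by (simp_all add: P_def finite_permutations card_permutations)
  have W: "finite (W p) \<and> card (W p) \<le> card (diagonal_symmetries F)" if "p \<in> P" for p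
  proof (cases "W p = {}")
    case False
    then obtain s where s: "\<And>i. s i \<noteq> 0" "monomial_matrix s p \<in> Aut F" by (auto simp: W_def)
    have p: "p permutes UNIV" using that by (simp add: P_def)
    let ?f = "\<lambda>t i. t i / s i"
    have inj: "inj_on ?f (W p)"
    proof (rule inj_onI)
      fix t u assume "?f t = ?f u"
      then have "t i / s i = u i / s i" for i by (rule fun_cong)
      then show "t = u" using s(1) by auto
    qed
    have sub: "?f ` W p \<subseteq> diagonal_symmetries F"
    proof
      fix u assume "u \<in> ?f ` W p"
      then obtain t where t: "u = ?f t" "\<And>i. t i \<noteq> 0" "monomial_matrix t p \<in> Aut F"
        by (auto simp: W_def)
      have "eval_poly F (\<chi> i. u i * x $ i) = eval_poly F x" for x
      proof -
        \<comment> \<open>The preimage of \<open>x\<close> under the fixed symmetry; applying the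
          other one to \<open>y\<close> scales \<open>x\<close> by the quotient
          \<open>u\<close>.\<close>
        define y where "y = (\<chi> k. x $ p k / s (p k))"
        have "monomial_matrix s p *v y = x" "monomial_matrix t p *v y = (\<chi> i. u i * x $ i)"
          using s(1) by (simp_all add: monomial_matrix_mult[OF p] y_def t(1) vec_eq_iff
              permutes_inverses[OF p])
        then show ?thesis using s(2) t(3) by (metis mem_Aut_iff)
      qed
      then show "u \<in> diagonal_symmetries F" using t s(1) by (simp add: diagonal_symmetries_def)
    qed
    show ?thesis
      using inj sub fin by (metis card_inj_on_le inj_on_finite)
  qed simp
  have sub: "Aut F \<subseteq> (\<Union>p\<in>P. (\<lambda>t. monomial_matrix t p) ` W p)"
  proof
    fix A assume A: "A \<in> Aut F"
    then obtain t p where "p permutes UNIV" "\<And>i. t i \<noteq> 0" "A = monomial_matrix t p"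
      using semi semi_permutation_monomial_matrix by metis
    then show "A \<in> (\<Union>p\<in>P. (\<lambda>t. monomial_matrix t p) ` W p)"
      using A by (auto simp: P_def W_def)
  qed
  have finU: "finite (\<Union>p\<in>P. (\<lambda>t. monomial_matrix t p) ` W p)" using P(1) W by blast
  then show "finite (Aut F)" using sub by (rule finite_subset[rotated])
  have "card (Aut F) \<le> card (\<Union>p\<in>P. (\<lambda>t. monomial_matrix t p) ` W p)"
    by (rule card_mono[OF finU sub])
  also have "\<dots> \<le> (\<Sum>p\<in>P. card ((\<lambda>t. monomial_matrix t p) ` W p))"
    by (rule card_UN_le[OF P(1)])
  also have "\<dots> \<le> (\<Sum>p\<in>P. card (diagonal_symmetries F))"
    using W by (intro sum_mono) (meson card_image_le le_trans)
  finally show "card (Aut F) \<le> card (diagonal_symmetries F) * fact CARD('r)"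
    by (simp add: P(2) mult.commute)
qed

section \<open>The equality case and the Fermat form\<close>

lemma card_root_functions:
  assumes "d > 0"
  shows "card {t :: 'r::finite \<Rightarrow> complex. \<forall>i. t i ^ d = 1} = d ^ CARD('r)"
proof -
  have "{t :: 'r \<Rightarrow> complex. \<forall>i. t i ^ d = 1} = (UNIV \<rightarrow>\<^sub>E {z. z ^ d = 1})"
    by (auto simp: PiE_def)
  then show ?thesis using assms by (simp add: card_funcsetE card_roots_unity_eq)
qed

text \<open>Conjugation by the isomorphism is injective on the monomial symmetries of the Fermat
  form. Finiteness matters because an infinite set has \<open>card\<close> zero.\<close>

lemma card_Aut_ge_isomorphic_fermat:
  fixes F :: "'r::finite cpoly"
  assumes d: "d > 0" and fin: "finite (Aut F)" and "isomorphic_forms F (fermat_form d)"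
  shows "d ^ CARD('r) * fact CARD('r) \<le> card (Aut F)"
proof -
  obtain A where A: "invertible A" "act A F = fermat_form d"
    using assms(3) by (auto simp: isomorphic_forms_def GL_def)
  obtain B where B: "A ** B = mat 1" "B ** A = mat 1"
    using A(1) by (auto simp: invertible_def)
  have F: "eval_poly F (A *v x) = (\<Sum>i\<in>UNIV. (x $ i) ^ d)" for x
    by (metis A(2) eval_poly_act eval_poly_fermat_form)
  have AB: "A *v (B *v x) = x" for x by (simp add: matrix_vector_mul_assoc B)
  define R where "R = {t :: 'r \<Rightarrow> complex. \<forall>i. t i ^ d = 1}"
  define P where "P = {p :: 'r \<Rightarrow> 'r. p permutes UNIV}"
  define f where "f = (\<lambda>(t, p). A ** monomial_matrix t p ** B)"
  have nz: "t i \<noteq> 0" if "t \<in> R" for t i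
    using that d by (auto simp: R_def power_0_left dest: spec[of _ i])
  have "inj_on f (R \<times> P)"
  proof (rule inj_onI)
    fix u v assume uv: "u \<in> R \<times> P" "v \<in> R \<times> P" "f u = f v"
    obtain t p s q where [simp]: "u = (t, p)" "v = (s, q)" by (metis surj_pair)
    have "B ** (A ** M ** B) ** A = M" for M :: "complex ^ 'r ^ 'r"
    proof -
      have "B ** (A ** M ** B) ** A = (B ** A) ** M ** (B ** A)"
        by (simp add: matrix_mul_assoc)
      then show ?thesis by (simp add: B)
    qed
    then have "monomial_matrix t p = monomial_matrix s q"
      using uv(3) by (simp add: f_def) metis
    then show "u = v" using uv(1) nz monomial_matrix_inject[of t p s q] by (simp add: P_def)
  qed
  moreover have "f ` (R \<times> P) \<subseteq> Aut F"
  proof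
    fix M assume "M \<in> f ` (R \<times> P)"
    then obtain t p where M: "t \<in> R" "p permutes UNIV" "M = A ** monomial_matrix t p ** B"
      by (auto simp: f_def P_def)
    have "invertible B" using B by (auto simp: invertible_def)
    then have "invertible M"
      using A(1) M nz by (auto intro!: invertible_mult simp: invertible_monomial_matrix_iff)
    moreover have "eval_poly F (M *v x) = eval_poly F x" for x
    proof -
      \<comment> \<open>In the coordinates \<open>y\<close> the form \<open>F\<close> is the Fermat
        form, whose sum survives permuting coordinates and multiplying them by \<open>d\<close>-th
        roots of unity.\<close>
      define y where "y = B *v x"
      have "eval_poly F (M *v x) = (\<Sum>i\<in>UNIV. (t i * y $ inv p i) ^ d)"
        by (simp add: M(3) y_def F monomial_matrix_mult[OF M(2)] flip: matrix_vector_mul_assoc)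
      also have "\<dots> = (\<Sum>i\<in>UNIV. (y $ inv p i) ^ d)"
        using M(1) by (simp add: power_mult_distrib R_def)
      also have "\<dots> = (\<Sum>i\<in>UNIV. (y $ i) ^ d)"
        using sum.permute[OF permutes_inv[OF M(2)], of "\<lambda>i. (y $ i) ^ d"] by (simp add: o_def)
      also have "\<dots> = eval_poly F x" using F[of y] by (simp add: y_def AB)
      finally show ?thesis .
    qed
    ultimately show "M \<in> Aut F" by (simp add: mem_Aut_iff)
  qed
  ultimately have "card (R \<times> P) \<le> card (Aut F)" using fin by (rule card_inj_on_le)
  then show ?thesis
    by (simp add: card_cartesian_product R_def P_def card_root_functions[OF d] card_permutations)
qed

text \<open>
  The group of \<open>d\<close>-th roots of unity has exactly \<open>d\<close> elements, so no exponent strictly between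
  \<open>0\<close> and \<open>d\<close> kills it.
\<close>

lemma keys_of_root_symmetries:
  fixes F :: "'r::finite cpoly"
  assumes d: "d > 0" and form: "form_of_degree d F"
    and roots: "{t. \<forall>i. t i ^ d = 1} \<subseteq> diagonal_symmetries F"
    and m: "m \<in> Poly_Mapping.keys F"
  obtains i where "m = Poly_Mapping.single i d"
proof -
  have sum: "(\<Sum>k\<in>UNIV. Poly_Mapping.lookup m k) = d"
    using form m by (simp add: form_of_degree_def)
  have lk: "Poly_Mapping.lookup m i = 0 \<or> Poly_Mapping.lookup m i = d" for i
  proof (rule ccontr)
    assume neg: "\<not> ?thesis"
    define n where "n = Poly_Mapping.lookup m i"
    have "n \<le> d"
      using sum member_le_sum[of i UNIV "Poly_Mapping.lookup m"] by (simp add: n_def)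
    then have n: "0 < n" "n < d" using neg by (auto simp: n_def)
    have "{z::complex. z ^ d = 1} \<subseteq> {z. z ^ n = 1}"
    proof
      \<comment> \<open>Placing a root of unity \<open>z\<close> in coordinate \<open>i\<close>
        alone isolates the exponent \<open>n\<close>.\<close>
      fix z :: complex assume z: "z \<in> {z. z ^ d = 1}"
      define t where "t = (\<lambda>k. if k = i then z else 1)"
      have "t \<in> diagonal_symmetries F" using roots z by (auto simp: t_def)
      from diagonal_symmetries_monomial[OF this m]
      have "(\<Prod>k\<in>UNIV. t k ^ Poly_Mapping.lookup m k) = 1" by (simp add: eval_monomial_def)
      moreover have "(\<Prod>k\<in>UNIV. t k ^ Poly_Mapping.lookup m k)
          = (\<Prod>k\<in>UNIV. if k = i then z ^ Poly_Mapping.lookup m k else 1)"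
        by (rule prod.cong) (auto simp: t_def)
      ultimately show "z \<in> {z. z ^ n = 1}" by (simp add: n_def)
    qed
    moreover have "finite {z::complex. z ^ n = 1}" using card_roots_mult_le(1)[OF n(1), of 1] by simp
    ultimately have "card {z::complex. z ^ d = 1} \<le> card {z::complex. z ^ n = 1}"
      by (intro card_mono)
    then show False using n by (simp add: card_roots_unity_eq)
  qed
  obtain i where i: "Poly_Mapping.lookup m i \<noteq> 0"
    using sum d by (metis less_irrefl sum.neutral)
  then have "Poly_Mapping.lookup m i = d" using lk[of i] by simp
  then have "(\<Sum>k\<in>UNIV - {i}. Poly_Mapping.lookup m k) = 0"
    using sum sum.remove[of UNIV i "Poly_Mapping.lookup m"] by simp
  then have "m = Poly_Mapping.single i d"
    using \<open>Poly_Mapping.lookup m i = d\<close>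
    by (intro poly_mapping_eqI) (auto simp: lookup_single when_def)
  then show ?thesis by (rule that)
qed

text \<open>All pure powers occur, so their coefficients are nonzero, and scaling the variables by
  \<open>d\<close>-th roots of the inverse coefficients normalises them to 1.\<close>

lemma isomorphic_fermat_formI:
  fixes F :: "'r::finite cpoly"
  assumes d: "d > 0" and keys: "Poly_Mapping.keys F = range (\<lambda>i. Poly_Mapping.single i d)"
  shows "isomorphic_forms F (fermat_form d)"
proof -
  define c where "c = (\<lambda>i. Poly_Mapping.lookup F (Poly_Mapping.single i d))"
  have inj: "inj (\<lambda>i::'r. Poly_Mapping.single i d)"
  proof (rule injI)
    fix i k :: 'r assume "Poly_Mapping.single i d = Poly_Mapping.single k d"
    then have "Poly_Mapping.lookup (Poly_Mapping.single i d) i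
      = Poly_Mapping.lookup (Poly_Mapping.single k d) i" by simp
    then show "i = k" using d by (auto simp: lookup_single when_def split: if_splits)
  qed
  have F: "eval_poly F x = (\<Sum>i\<in>UNIV. c i * (x $ i) ^ d)" for x
    by (simp add: eval_poly_eq keys sum.reindex[OF inj] c_def)
  have c: "c i \<noteq> 0" for i
    using keys by (auto simp: c_def simp flip: in_keys_iff)
  have "\<exists>z. z ^ d = 1 / c i" for i
  proof -
    have "card {z. z ^ d = 1 / c i} \<noteq> 0"
      using card_nth_roots[of "1 / c i" d] c[of i] d by simp
    then have "{z. z ^ d = 1 / c i} \<noteq> {}" by (metis card.empty)
    then show ?thesis by blast
  qed
  then obtain a where a: "\<And>i. a i ^ d = 1 / c i" by metis
  define A where "A = monomial_matrix a id"
  have id: "id permutes (UNIV :: 'r set)" by (rule permutes_id)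
  have "a i \<noteq> 0" for i
    using a[of i] c[of i] d by (auto simp: power_0_left)
  then have "A \<in> GL" by (simp add: GL_def A_def invertible_monomial_matrix_iff[OF id])
  moreover have "act A F = fermat_form d"
    unfolding eval_poly_eq_iff eval_poly_act eval_poly_fermat_form
    using a c by (simp add: A_def F monomial_matrix_mult[OF id] power_mult_distrib inv_id)
  ultimately show ?thesis by (auto simp: isomorphic_forms_def)
qed

text \<open>Finiteness is stated separately, since a bound on \<open>card\<close> alone would also
  hold for an infinite group.\<close>

theorem theorem3p9:
  fixes F :: "'r::finite cpoly" and d :: nat
  assumes "CARD('r) \<ge> 2"
    and "d \<ge> 3"
    and "form_of_degree d F"
    and "smooth_form F"
    and "\<forall>A\<in>Aut F. semi_permutation A"
  shows "finite (Aut F)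
    \<and> card (Aut F) \<le> d ^ CARD('r) * fact CARD('r)
    \<and> (card (Aut F) = d ^ CARD('r) * fact CARD('r) \<longleftrightarrow> isomorphic_forms F (fermat_form d))"
proof -
  let ?D = "diagonal_symmetries F"
  obtain j where j: "\<And>i. Poly_Mapping.single i (d - 1) + Poly_Mapping.single (j i) 1
      \<in> Poly_Mapping.keys F"
    using smooth_form_near_power[OF assms(3,4)] by metis
  note system = card_monomial_system[OF assms(2), of j]
  have sub: "?D \<subseteq> monomial_system d j"
    by (rule diagonal_symmetries_subset_monomial_system[OF j])
  have finD: "finite ?D" and leD: "card ?D \<le> card (monomial_system d j)"
    using sub system(1) by (auto intro: finite_subset card_mono)
  have D: "card ?D \<le> d ^ CARD('r)" using leD system(2) by simp
  note Aut = card_Aut_le[OF assms(5) finD]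
  have le: "card (Aut F) \<le> d ^ CARD('r) * fact CARD('r)"
    using Aut(2) D by (meson le_trans mult_le_mono1)
  have "isomorphic_forms F (fermat_form d)" if eq: "card (Aut F) = d ^ CARD('r) * fact CARD('r)"
  proof -
    \<comment> \<open>Equality forces equality throughout the chain of bounds: the diagonal
      symmetries fill the whole system, and the system has maximal size.\<close>
    have "d ^ CARD('r) * fact CARD('r) \<le> card ?D * fact CARD('r)" using Aut(2) eq by simp
    then have "d ^ CARD('r) \<le> card ?D" by simp
    then have cardD: "card ?D = card (monomial_system d j)"
      "card (monomial_system d j) = d ^ CARD('r)"
      using leD system(2) by simp_all
    have fixed: "j i = i" for i using system(3)[of i] cardD(2) by fastforce
    have "?D = monomial_system d j" by (rule card_subset_eq[OF system(1) sub cardD(1)])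
    also have "\<dots> = {t. \<forall>i. t i ^ d = 1}"
      using assms(2) by (simp only: monomial_system_def fixed power_minus_mult)
    finally have roots: "{t. \<forall>i. t i ^ d = 1} \<subseteq> ?D" by simp
    \<comment> \<open>Since \<open>j\<close> fixes \<open>i\<close>, the monomial provided by
      smoothness is the pure \<open>d\<close>-th power.\<close>
    have "Poly_Mapping.single i d \<in> Poly_Mapping.keys F" for i
      using j[of i] assms(2) by (simp add: fixed flip: single_add)
    moreover have "m \<in> range (\<lambda>i. Poly_Mapping.single i d)" if "m \<in> Poly_Mapping.keys F" for m
      using keys_of_root_symmetries[OF _ assms(3) roots that] assms(2) by auto
    ultimately have "Poly_Mapping.keys F = range (\<lambda>i. Poly_Mapping.single i d)" by blast
    then show ?thesis using isomorphic_fermat_formI[of d F] assms(2) by simp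
  qed
  moreover have "card (Aut F) = d ^ CARD('r) * fact CARD('r)"
    if "isomorphic_forms F (fermat_form d)"
    using card_Aut_ge_isomorphic_fermat[OF _ Aut(1) that] assms(2) le by simp
  ultimately show ?thesis using Aut(1) le by blast
qed

end
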